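(* Let $M,N\ge 2$ be integers. If a subset $U$ of the space $\mathfrak{M}(M,N)=\mathbb{R}^{MN^2}$ satisfies $E(M,N)\subseteq U\subseteq S(M,N)$, then $U$ is not semialgebraic.
   Context: A class $\mathfrak{A}=\{A_1,A_2,\ldots,A_M\}$ of $M$ real square matrices of dimension $N$ (with $A_k=(a_{kij})$) is identified with the point of $\mathfrak{M}(M,N)=\mathbb{R}^{MN^2}$ whose coordinates are the $MN^2$ entries $a_{kij}$, i.e. a point of $\mathfrak{M}(M,N)$ is an $M$-tuple of $N\times N$ real matrices. Let $\|\cdot\|$ be a norm on $\mathbb{R}^N$ (the choice is immaterial, since all norms on $\mathbb{R}^N$ are equivalent). Consider the system $x(n)=A(n)x(n-1)$, $n=1,2,\ldots$, with $x(n)\in\mathbb{R}^N$. The system is absolutely stable with respect to $\mathfrak{A}$ if there exists $c=c(\mathfrak{A})$ such that for any sequence of matrices $A(n)\in\mathfrak{A}$, any $x\in\mathbb{R}^N$ and all $n=1,2,\ldots$, $\|A(n)A(n-1)\cdots A(1)x\|\le c\|x\|$. The system is absolutely exponentially stable with respect to $\mathfrak{A}$ if there exist $c=c(\mathfrak{A})$ and $q=q(\mathfrak{A})<1$ such that for any sequence of matrices $A(n)\in\mathfrak{A}$, any $x\in\mathbb{R}^N$ and all $n=1,2,\ldots$, $\|A(n)A(n-1)\cdots A(1)x\|\le cq^n\|x\|$. $S(M,N)$ (respectively $E(M,N)$) denotes the set of those $\mathfrak{A}\in\mathfrak{M}(M,N)$ with respect to which the system is absolutely stable (respectively absolutely exponentially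 stable). A set $U\subseteq\mathbb{R}^L$ has the SA-property if there are finitely many real polynomials $p_1,\ldots,p_k,p_{k+1},\ldots,p_{k+l}$ in $u\in\mathbb{R}^L$ such that $U$ is the set of all $u\in\mathbb{R}^L$ with $p_1(u)>0,\ldots,p_k(u)>0$ and $p_{k+1}(u)=\cdots=p_{k+l}(u)=0$. A set is semialgebraic if it is a union of finitely many sets possessing the SA-property. *)

theory Defs
  imports "HOL-Analysis.Analysis"
begin

definition is_norm :: "('a::real_vector \<Rightarrow> real) \<Rightarrow> bool" where
  "is_norm \<nu> \<longleftrightarrow>
     (\<forall>x. 0 \<le> \<nu> x) \<and>
     (\<forall>x. \<nu> x = 0 \<longleftrightarrow> x = 0) \<and>
     (\<forall>c x. \<nu> (c *\<^sub>R x) = \<bar>c\<bar> * \<nu> x) \<and>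
     (\<forall>x y. \<nu> (x + y) \<le> \<nu> x + \<nu> y)"

(* matprod A n = A(n) ** A(n-1) ** ... ** A(1); the value A 0 is never used. *)
primrec matprod :: "(nat \<Rightarrow> real^'n^'n) \<Rightarrow> nat \<Rightarrow> real^'n^'n" where
  "matprod A 0 = mat 1"
| "matprod A (Suc n) = A (Suc n) ** matprod A n"

definition absolutely_stable ::
    "(real^'n \<Rightarrow> real) \<Rightarrow> (real^'n^'n) set \<Rightarrow> bool" where
  "absolutely_stable \<nu> \<AA> \<longleftrightarrow>
     (\<exists>c. \<forall>A. (\<forall>n\<ge>1. A n \<in> \<AA>) \<longrightarrow>
        (\<forall>x. \<forall>n\<ge>1. \<nu> (matprod A n *v x) \<le> c * \<nu> x))"

definition absolutely_exponentially_stable ::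
    "(real^'n \<Rightarrow> real) \<Rightarrow> (real^'n^'n) set \<Rightarrow> bool" where
  "absolutely_exponentially_stable \<nu> \<AA> \<longleftrightarrow>
     (\<exists>c q. q < 1 \<and> (\<forall>A. (\<forall>n\<ge>1. A n \<in> \<AA>) \<longrightarrow>
        (\<forall>x. \<forall>n\<ge>1. \<nu> (matprod A n *v x) \<le> c * q ^ n * \<nu> x)))"

(* A point a :: real^'n^'n^'m is an M-tuple of N x N matrices, M = CARD('m), N = CARD('n),
   with coordinates a $ k $ i $ j; the class of matrices it represents is range (($) a). *)
definition stable_tuples :: "(real^'n \<Rightarrow> real) \<Rightarrow> (real^'n^'n^'m) set" where
  "stable_tuples \<nu> = {a. absolutely_stable \<nu> (range (($) a))}"

definition exp_stable_tuples :: "(real^'n \<Rightarrow> real) \<Rightarrow> (real^'n^'n^'m) set" where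
  "exp_stable_tuples \<nu> = {a. absolutely_exponentially_stable \<nu> (range (($) a))}"

(* On a Euclidean space, real_polynomial_function describes exactly the functions given by
   real polynomials in the coordinates: it is generated from linear forms and constants by
   sums and products. *)
definition SA_property :: "'a::euclidean_space set \<Rightarrow> bool" where
  "SA_property U \<longleftrightarrow>
     (\<exists>P Q. finite P \<and> finite Q \<and>
        (\<forall>p \<in> P \<union> Q. real_polynomial_function p) \<and>
        U = {u. (\<forall>p\<in>P. p u > 0) \<and> (\<forall>p\<in>Q. p u = 0)})"

definition semialgebraic :: "'a::euclidean_space set \<Rightarrow> bool" where
  "semialgebraic U \<longleftrightarrow> (\<exists>F. finite F \<and> (\<forall>V\<in>F. SA_property V) \<and> U = \<Union>F)"

end

theory Submission
  imports Defs "HOL-Real_Asymp.Real_Asymp"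
begin

text \<open>
  A semialgebraic set meets a polynomial curve \<open>\<gamma>\<close> tamely: for all sufficiently small
  \<open>s > 0\<close>, the point \<open>\<gamma> s\<close> lies inside the set, or for all of them it lies outside
  (\<open>semialgebraic_decided_along_curve\<close>).  It therefore suffices to find one polynomial curve in the
  space of tuples that, for parameters tending to \<open>0\<close>, is infinitely often exponentially stable and
  infinitely often not even stable.

  All the matrices of the curve act in one fixed coordinate plane and vanish on the other
  coordinates.  Put \<open>s = tan \<theta>\<close> and \<open>\<lambda> = 1 - s\<^sup>4\<close>.  One matrix of the tuple is \<open>H = \<lambda> R\<close>, where \<open>R\<close>
  is the rotation of the plane by \<open>2 \<theta>\<close>; all others are equal to \<open>G = \<lambda> P\<close>, where \<open>P\<close> is the rank one
  projection \<open>x \<mapsto> (x\<^sub>i - s x\<^sub>j) e\<^sub>i\<close>.  A product in which \<open>G\<close> occurs at least twice is governed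
  by the factors
    \<open>P R\<^sup>n P = (cos ((2 n + 1) \<theta>) / cos \<theta>) P\<close>,
  one for each pair of consecutive occurrences of \<open>G\<close>.

  If \<open>\<theta> = \<pi> / (2 k)\<close>, an odd multiple of \<open>\<theta>\<close> is never closer than \<open>\<theta>\<close> to a multiple of \<open>\<pi>\<close>.
  So all these factors are at most \<open>1\<close> in absolute value, and the damping \<open>\<lambda> < 1\<close> gives
  exponential stability (\<open>exponentially_stable_at_even_fractions\<close>).

  If \<open>\<theta> = \<pi> / (2 k + 1)\<close>, then \<open>n = k\<close> gives the factor \<open>-1 / cos \<theta>\<close>, and \<open>G H\<^sup>k\<close> multiplies
  \<open>e\<^sub>i\<close> by \<open>- \<lambda>\<^sup>k\<^sup>+\<^sup>1 / cos \<theta>\<close>.  Here \<open>1 / cos \<theta>\<close> exceeds \<open>1\<close> by about \<open>\<theta>\<^sup>2 / 2\<close>, while the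
  damping over \<open>k + 1 \<approx> \<pi> / (2 \<theta>)\<close> steps costs only about \<open>\<pi> \<theta>\<^sup>3 / 2\<close>.  For large \<open>k\<close> the factor
  exceeds \<open>1\<close> in absolute value, and the powers of \<open>G H\<^sup>k\<close> are unbounded
  (\<open>unstable_at_odd_fractions\<close>).

  The damping \<open>1 - s\<^sup>4\<close> is weak enough for this and has a second virtue: its factor \<open>1 + s\<^sup>2\<close> cancels
  the denominator in \<open>cos (2 \<theta>) = (1 - s\<^sup>2) / (1 + s\<^sup>2)\<close> and \<open>sin (2 \<theta>) = 2 s / (1 + s\<^sup>2)\<close>, so that
  all matrix entries are polynomials in \<open>s\<close>.
\<close>

section \<open>Semialgebraic sets along polynomial curves\<close>

text \<open>
  The predicates that are eventually true or eventually false form a Boolean algebra.  The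
  semialgebraic conditions along a curve are finite Boolean combinations of polynomial sign
  conditions, so only the latter need a proof.
\<close>

definition decided :: "('a \<Rightarrow> bool) \<Rightarrow> 'a filter \<Rightarrow> bool" where
  "decided P F \<longleftrightarrow> eventually P F \<or> eventually (\<lambda>x. \<not> P x) F"

lemma decided_not: "decided P F \<Longrightarrow> decided (\<lambda>x. \<not> P x) F"
  by (auto simp: decided_def)

lemma decided_conj:
  assumes "decided P F" "decided Q F"
  shows "decided (\<lambda>x. P x \<and> Q x) F"
proof -
  consider "eventually P F" "eventually Q F"
    | "eventually (\<lambda>x. \<not> P x) F" | "eventually (\<lambda>x. \<not> Q x) F"
    using assms unfolding decided_def by blast
  then show ?thesis
  proof cases
    case 1
    then show ?thesis by (simp add: decided_def eventually_conj_iff)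
  next
    case 2
    then have "eventually (\<lambda>x. \<not> (P x \<and> Q x)) F" by eventually_elim simp
    then show ?thesis by (simp add: decided_def)
  next
    case 3
    then have "eventually (\<lambda>x. \<not> (P x \<and> Q x)) F" by eventually_elim simp
    then show ?thesis by (simp add: decided_def)
  qed
qed

lemma decided_ball:
  assumes "finite I" "\<And>i. i \<in> I \<Longrightarrow> decided (P i) F"
  shows "decided (\<lambda>x. \<forall>i\<in>I. P i x) F"
  using assms
proof (induction I rule: finite_induct)
  case empty
  then show ?case by (simp add: decided_def)
next
  case (insert i I)
  then have "decided (\<lambda>x. P i x \<and> (\<forall>i\<in>I. P i x)) F"
    by (intro decided_conj) auto
  then show ?case by simp
qed

lemma decided_bex:
  assumes "finite I" "\<And>i. i \<in> I \<Longrightarrow> decided (P i) F"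
  shows "decided (\<lambda>x. \<exists>i\<in>I. P i x) F"
proof -
  have "decided (\<lambda>x. \<not> (\<forall>i\<in>I. \<not> P i x)) F"
    by (intro decided_not decided_ball assms)
  then show ?thesis by simp
qed

lemma real_polynomial_function_imp_poly:
  fixes f :: "real \<Rightarrow> real"
  assumes "real_polynomial_function f"
  shows "\<exists>q. f = poly q"
proof -
  obtain a n where f: "f = (\<lambda>x. \<Sum>i\<le>n. a i * x ^ i)"
    using real_polynomial_function_imp_sum[OF assms] by blast
  have "f = poly (\<Sum>i\<le>n. monom (a i) i)"
    by (auto simp: f poly_sum poly_monom)
  then show ?thesis ..
qed

text \<open>
  The lowest nonzero coefficient determines the sign: a nonzero constant term is the limit at
  \<open>0\<close>, and a zero constant term allows a division by the positive variable.
\<close>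

lemma poly_sign_at_right_0:
  fixes q :: "real poly"
  shows "eventually (\<lambda>x. poly q x > 0) (at_right 0) \<or>
         eventually (\<lambda>x. poly q x = 0) (at_right 0) \<or>
         eventually (\<lambda>x. poly q x < 0) (at_right 0)"
proof (induction q rule: pCons_induct)
  case 0
  then show ?case by simp
next
  case (pCons a q)
  have pos: "eventually (\<lambda>x::real. x > 0) (at_right 0)"
    by (rule eventually_at_right_less)
  show ?case
  proof (cases "a = 0")
    case True
    from pCons.IH show ?thesis
    proof (elim disjE)
      assume "eventually (\<lambda>x. poly q x > 0) (at_right 0)"
      with pos have "eventually (\<lambda>x. poly (pCons a q) x > 0) (at_right 0)"
        by eventually_elim (simp add: True)
      then show ?thesis by blast
    next
      assume "eventually (\<lambda>x. poly q x = 0) (at_right 0)"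
      then have "eventually (\<lambda>x. poly (pCons a q) x = 0) (at_right 0)"
        by eventually_elim (simp add: True)
      then show ?thesis by blast
    next
      assume "eventually (\<lambda>x. poly q x < 0) (at_right 0)"
      with pos have "eventually (\<lambda>x. poly (pCons a q) x < 0) (at_right 0)"
        by eventually_elim (simp add: True mult_pos_neg)
      then show ?thesis by blast
    qed
  next
    case False
    have "isCont (poly (pCons a q)) 0"
      by (rule poly_isCont)
    then have "(poly (pCons a q) \<longlongrightarrow> poly (pCons a q) 0) (at_right 0)"
      unfolding isCont_def by (rule tendsto_mono[OF at_le[OF subset_UNIV]])
    then have lim: "(poly (pCons a q) \<longlongrightarrow> a) (at_right 0)"
      by simp
    show ?thesis
      using False order_tendstoD[OF lim, of 0] by (cases "a > 0") auto
  qed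
qed

lemma decided_real_polynomial_function:
  assumes "real_polynomial_function (f :: real \<Rightarrow> real)"
  shows "decided (\<lambda>x. f x > 0) (at_right 0)" "decided (\<lambda>x. f x = 0) (at_right 0)"
proof -
  obtain q where f: "f = poly q"
    using real_polynomial_function_imp_poly[OF assms] by blast
  consider "eventually (\<lambda>x. f x > 0) (at_right 0)" | "eventually (\<lambda>x. f x = 0) (at_right 0)"
    | "eventually (\<lambda>x. f x < 0) (at_right 0)"
    using poly_sign_at_right_0[of q] unfolding f by blast
  then have "decided (\<lambda>x. f x > 0) (at_right 0) \<and> decided (\<lambda>x. f x = 0) (at_right 0)"
    unfolding decided_def
    by cases (smt (verit) eventually_mono)+
  then show "decided (\<lambda>x. f x > 0) (at_right 0)" "decided (\<lambda>x. f x = 0) (at_right 0)"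
    by blast+
qed

lemma semialgebraic_decided_along_curve:
  fixes \<gamma> :: "real \<Rightarrow> 'a::euclidean_space"
  assumes U: "semialgebraic U" and \<gamma>: "polynomial_function \<gamma>"
  shows "decided (\<lambda>s. \<gamma> s \<in> U) (at_right 0)"
proof -
  obtain F where F: "finite F" "\<And>V. V \<in> F \<Longrightarrow> SA_property V" "U = \<Union>F"
    using U unfolding semialgebraic_def by blast
  have "decided (\<lambda>s. \<gamma> s \<in> V) (at_right 0)" if V_in: "V \<in> F" for V
  proof -
    obtain P Q where PQ: "finite P" "finite Q"
        "\<And>p. p \<in> P \<union> Q \<Longrightarrow> real_polynomial_function p"
        and V: "V = {u. (\<forall>p\<in>P. p u > 0) \<and> (\<forall>p\<in>Q. p u = 0)}"
      using F(2)[OF V_in] unfolding SA_property_def by blast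
    have poly: "real_polynomial_function (\<lambda>s. p (\<gamma> s))" if "p \<in> P \<union> Q" for p
      using real_polynomial_function_compose[OF \<gamma> PQ(3)[OF that]] by (simp add: o_def)
    have "decided (\<lambda>s. (\<forall>p\<in>P. p (\<gamma> s) > 0) \<and> (\<forall>p\<in>Q. p (\<gamma> s) = 0)) (at_right 0)"
      using PQ(1,2) poly
      by (intro decided_conj decided_ball decided_real_polynomial_function) auto
    then show ?thesis by (simp add: V)
  qed
  then have "decided (\<lambda>s. \<exists>V\<in>F. \<gamma> s \<in> V) (at_right 0)"
    using F(1) by (intro decided_bex)
  then show ?thesis by (simp add: F(3))
qed


section \<open>Equivalence of norms\<close>

lemma is_norm_upper_bound:
  fixes \<nu> :: "'a::euclidean_space \<Rightarrow> real"
  assumes "is_norm \<nu>"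
  shows "\<exists>C. \<forall>x. \<nu> x \<le> C * norm x"
proof -
  have scale: "\<nu> (c *\<^sub>R x) = \<bar>c\<bar> * \<nu> x" and triangle: "\<nu> (x + y) \<le> \<nu> x + \<nu> y"
    and nonneg: "0 \<le> \<nu> x" for c x y
    using assms by (auto simp: is_norm_def)
  have zero: "\<nu> 0 = 0"
    using assms by (auto simp: is_norm_def)
  have sum: "\<nu> (sum f I) \<le> (\<Sum>i\<in>I. \<nu> (f i))" if "finite I" for f :: "'a \<Rightarrow> 'a" and I
    using that
  proof (induction I rule: finite_induct)
    case empty
    then show ?case by (simp add: zero)
  next
    case (insert i I)
    have "\<nu> (f i + sum f I) \<le> \<nu> (f i) + \<nu> (sum f I)" by (rule triangle)
    with insert show ?case by simp
  qed
  have "\<nu> x \<le> (\<Sum>b\<in>Basis. \<nu> b) * norm x" for x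
  proof -
    have "\<nu> x = \<nu> (\<Sum>b\<in>Basis. (x \<bullet> b) *\<^sub>R b)"
      by (simp add: euclidean_representation)
    also have "\<dots> \<le> (\<Sum>b\<in>Basis. \<nu> ((x \<bullet> b) *\<^sub>R b))"
      by (rule sum) simp
    also have "\<dots> = (\<Sum>b\<in>Basis. \<bar>x \<bullet> b\<bar> * \<nu> b)"
      by (simp add: scale)
    also have "\<dots> \<le> (\<Sum>b\<in>Basis. norm x * \<nu> b)"
      by (intro sum_mono mult_right_mono Basis_le_norm nonneg)
    also have "\<dots> = (\<Sum>b\<in>Basis. \<nu> b) * norm x"
      by (simp add: sum_distrib_left mult.commute)
    finally show ?thesis .
  qed
  then show ?thesis by blast
qed

text \<open>
  By the upper bound \<open>\<nu>\<close> is continuous, so it attains a positive minimum on the compact unit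
  sphere.
\<close>

lemma is_norm_lower_bound:
  fixes \<nu> :: "'a::euclidean_space \<Rightarrow> real"
  assumes "is_norm \<nu>"
  shows "\<exists>c>0. \<forall>x. c * norm x \<le> \<nu> x"
proof -
  have scale: "\<nu> (c *\<^sub>R x) = \<bar>c\<bar> * \<nu> x" and triangle: "\<nu> (x + y) \<le> \<nu> x + \<nu> y"
    and nonneg: "0 \<le> \<nu> x" and zero: "\<nu> x = 0 \<longleftrightarrow> x = 0" for c x y
    using assms by (auto simp: is_norm_def)
  obtain C where C: "\<And>x. \<nu> x \<le> C * norm x"
    using is_norm_upper_bound[OF assms] by blast
  have lipschitz: "\<bar>\<nu> x - \<nu> y\<bar> \<le> C * norm (x - y)" for x y
  proof -
    have "\<nu> x \<le> \<nu> (x - y) + \<nu> y" "\<nu> y \<le> \<nu> (y - x) + \<nu> x"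
      using triangle[of "x - y" y] triangle[of "y - x" x] by simp_all
    then show ?thesis
      using C[of "x - y"] C[of "y - x"] by (simp add: norm_minus_commute abs_le_iff)
  qed
  have "((\<lambda>y. \<nu> y) \<longlongrightarrow> \<nu> x) (at x)" for x
  proof (rule Lim_null_comparison[THEN LIM_zero_cancel])
    show "\<forall>\<^sub>F y in at x. norm (\<nu> y - \<nu> x) \<le> C * norm (y - x)"
      using lipschitz by simp
    show "((\<lambda>y. C * norm (y - x)) \<longlongrightarrow> 0) (at x)"
      by (rule tendsto_eq_intros refl | simp)+
  qed
  then have cont: "continuous_on (sphere 0 1) \<nu>"
    by (intro continuous_at_imp_continuous_on) (simp add: isCont_def)
  obtain b :: 'a where b: "b \<in> Basis"
    using nonempty_Basis by blast
  then have "sphere (0::'a) 1 \<noteq> {}"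
    by (metis mem_sphere_0 norm_Basis empty_iff)
  then obtain z where z: "norm z = 1" "\<And>y. norm y = 1 \<Longrightarrow> \<nu> z \<le> \<nu> y"
    using continuous_attains_inf[OF compact_sphere _ cont] by auto
  have "\<nu> z * norm x \<le> \<nu> x" for x
  proof (cases "x = 0")
    case False
    then have "\<nu> z \<le> \<nu> ((1 / norm x) *\<^sub>R x)"
      by (intro z(2)) simp
    with False show ?thesis by (simp add: scale field_simps)
  qed (use zero[of 0] in simp)
  moreover have "\<nu> z > 0"
    using z(1) zero[of z] nonneg[of z] by fastforce
  ultimately show ?thesis by blast
qed

section \<open>Matrices acting in a coordinate plane\<close>

definition planar_matrix :: "'n \<Rightarrow> 'n \<Rightarrow> real \<Rightarrow> real \<Rightarrow> real \<Rightarrow> real \<Rightarrow> real^'n^'n" where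
  "planar_matrix i j a b c d =
     (\<chi> p q. if p = i \<and> q = i then a else if p = i \<and> q = j then b
            else if p = j \<and> q = i then c else if p = j \<and> q = j then d else 0)"

lemma planar_matrix_mult_vec:
  fixes x :: "real^'n"
  assumes "i \<noteq> j"
  shows "planar_matrix i j a b c d *v x =
           (a * x $ i + b * x $ j) *\<^sub>R axis i 1 + (c * x $ i + d * x $ j) *\<^sub>R axis j 1"
proof -
  have two: "(\<Sum>q\<in>UNIV. (if q = i then \<alpha> else if q = j then \<beta> else 0) * x $ q) =
        \<alpha> * x $ i + \<beta> * x $ j" for \<alpha> \<beta>
  proof -
    have "(\<Sum>q\<in>UNIV. (if q = i then \<alpha> else if q = j then \<beta> else 0) * x $ q) =
          (\<Sum>q\<in>UNIV. (if q = i then \<alpha> * x $ q else 0) + (if q = j then \<beta> * x $ q else 0))"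
      using assms by (intro sum.cong) auto
    then show ?thesis by (simp add: sum.distrib)
  qed
  show ?thesis
    using assms
    by (auto simp: vec_eq_iff planar_matrix_def matrix_vector_mult_def axis_def two cong: if_cong)
qed

lemma norm_planar_vec:
  assumes "i \<noteq> j"
  shows "norm (a *\<^sub>R axis i 1 + b *\<^sub>R axis j 1 :: real^'n) = sqrt (a\<^sup>2 + b\<^sup>2)"
  using assms
  by (simp add: norm_eq_sqrt_inner inner_add_left inner_add_right inner_axis_axis power2_eq_square)

lemma norm_planar_projection_le:
  fixes x :: "real^'n"
  assumes "i \<noteq> j"
  shows "sqrt ((x $ i)\<^sup>2 + (x $ j)\<^sup>2) \<le> norm x"
proof -
  have "(\<Sum>p\<in>{i,j}. (x $ p)\<^sup>2) \<le> (\<Sum>p\<in>UNIV. (x $ p)\<^sup>2)"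
    by (rule sum_mono2) auto
  then show ?thesis
    using assms by (simp add: norm_vec_def L2_set_def)
qed

lemma matprod_Suc_mult_vec: "matprod A (Suc n) *v x = A (Suc n) *v (matprod A n *v x)"
  by (simp add: matrix_vector_mul_assoc)

section \<open>The curve of tuples\<close>

text \<open>
  For \<open>s = tan \<theta>\<close> this is \<open>(1 - s\<^sup>4)\<close> times the rotation by \<open>2 \<theta>\<close> in the plane of the
  coordinates \<open>i\<close> and \<open>j\<close>, see \<open>damped_rotation_tan_mult_vec\<close>.
\<close>

definition damped_rotation :: "'n \<Rightarrow> 'n \<Rightarrow> real \<Rightarrow> real^'n^'n" where
  "damped_rotation i j s =
     planar_matrix i j ((1 - s\<^sup>2)\<^sup>2) (- (2 * s * (1 - s\<^sup>2))) (2 * s * (1 - s\<^sup>2)) ((1 - s\<^sup>2)\<^sup>2)"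

definition damped_projection :: "'n \<Rightarrow> 'n \<Rightarrow> real \<Rightarrow> real^'n^'n" where
  "damped_projection i j s = planar_matrix i j (1 - s ^ 4) (- (s * (1 - s ^ 4))) 0 0"

definition rotation_projection_tuple :: "'m \<Rightarrow> 'n \<Rightarrow> 'n \<Rightarrow> real \<Rightarrow> real^'n^'n^'m" where
  "rotation_projection_tuple k i j s =
     (\<chi> l. if l = k then damped_rotation i j s else damped_projection i j s)"

lemma range_rotation_projection_tuple:
  assumes "l \<noteq> k"
  shows "range (($) (rotation_projection_tuple k i j s)) =
           {damped_rotation i j s, damped_projection i j s}"
proof -
  have "rotation_projection_tuple k i j s $ k = damped_rotation i j s"
       "rotation_projection_tuple k i j s $ l = damped_projection i j s"
    using assms by (simp_all add: rotation_projection_tuple_def)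
  then have "damped_rotation i j s \<in> range (($) (rotation_projection_tuple k i j s))"
       "damped_projection i j s \<in> range (($) (rotation_projection_tuple k i j s))"
    by (metis rangeI)+
  then show ?thesis
    by (auto simp: rotation_projection_tuple_def)
qed

lemma polynomial_function_vec:
  fixes f :: "real \<Rightarrow> ('a::euclidean_space)^'n"
  assumes "\<And>p. polynomial_function (\<lambda>s. f s $ p)"
  shows "polynomial_function f"
  unfolding polynomial_function_iff_Basis_inner
proof
  fix b :: "'a^'n" assume "b \<in> Basis"
  then obtain p u where "b = axis p u" "u \<in> Basis"
    by (auto simp: Basis_vec_def)
  then show "real_polynomial_function (\<lambda>s. f s \<bullet> b)"
    using assms[of p] by (simp add: inner_axis polynomial_function_iff_Basis_inner)
qed

lemma polynomial_rotation_projection_tuple: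
  "polynomial_function (rotation_projection_tuple k i j)"
proof -
  have id: "real_polynomial_function (\<lambda>s::real. s)"
    by (simp add: real_polynomial_function_eq)
  have const: "real_polynomial_function (\<lambda>s::real. c)" for c
    by (simp add: real_polynomial_function_eq)
  note intros = id const real_polynomial_function_power real_polynomial_function_diff
    real_polynomial_function_minus real_polynomial_function.intros(4)
  have "real_polynomial_function (\<lambda>s. rotation_projection_tuple k i j s $ l $ p $ q)" for l p q
    unfolding rotation_projection_tuple_def damped_rotation_def damped_projection_def
      planar_matrix_def
    by (cases "l = k"; cases "p = i"; cases "p = j"; cases "q = i"; cases "q = j"; simp; intro intros)
  then show ?thesis
    by (intro polynomial_function_vec) (simp add: real_polynomial_function_eq)
qed

text \<open>
  The polynomial entries are the double-angle formulas in terms of \<open>tan \<theta>\<close>, with the denominator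
  \<open>1 + tan\<^sup>2 \<theta>\<close> cancelled against the damping
  \<open>1 - tan\<^sup>4 \<theta> = (1 + tan\<^sup>2 \<theta>) (1 - tan\<^sup>2 \<theta>)\<close>.
\<close>

lemma damped_rotation_tan_mult_vec:
  assumes "i \<noteq> j" "cos \<theta> \<noteq> 0"
  shows "damped_rotation i j (tan \<theta>) *v x =
           (1 - tan \<theta> ^ 4) *\<^sub>R ((cos (2 * \<theta>) * x $ i - sin (2 * \<theta>) * x $ j) *\<^sub>R axis i 1 +
                               (sin (2 * \<theta>) * x $ i + cos (2 * \<theta>) * x $ j) *\<^sub>R axis j 1)"
proof -
  let ?s = "tan \<theta>"
  have factor: "1 - ?s ^ 4 = (1 + ?s\<^sup>2) * (1 - ?s\<^sup>2)"
    by (simp add: algebra_simps power2_eq_square power4_eq_xxxx)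
  have inv: "1 + ?s\<^sup>2 = 1 / (cos \<theta>)\<^sup>2"
    using assms(2) by (simp add: tan_sec divide_inverse power_inverse)
  have c: "(1 + ?s\<^sup>2) * cos (2 * \<theta>) = 1 - ?s\<^sup>2"
    unfolding inv cos_double using assms(2) by (simp add: tan_def field_simps)
  have s: "(1 + ?s\<^sup>2) * sin (2 * \<theta>) = 2 * ?s"
    unfolding inv sin_double using assms(2)
    by (simp add: tan_def field_simps power2_eq_square)
  have "(1 - ?s ^ 4) * cos (2 * \<theta>) = (1 - ?s\<^sup>2) * ((1 + ?s\<^sup>2) * cos (2 * \<theta>))"
    unfolding factor by simp
  then have cos: "(1 - ?s ^ 4) * cos (2 * \<theta>) = (1 - ?s\<^sup>2)\<^sup>2"
    unfolding c by (simp only: power2_eq_square)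
  have sin: "(1 - ?s ^ 4) * sin (2 * \<theta>) = 2 * ?s * (1 - ?s\<^sup>2)"
    unfolding factor s[symmetric] by (simp add: algebra_simps)
  show ?thesis
    unfolding damped_rotation_def planar_matrix_mult_vec[OF assms(1)] cos[symmetric] sin[symmetric]
    by (simp add: algebra_simps)
qed

lemma damped_projection_tan_mult_vec:
  assumes "i \<noteq> j" "cos \<theta> \<noteq> 0"
  shows "damped_projection i j (tan \<theta>) *v x =
           ((1 - tan \<theta> ^ 4) * ((cos \<theta> * x $ i - sin \<theta> * x $ j) / cos \<theta>)) *\<^sub>R axis i 1"
  using assms
  by (simp add: damped_projection_def planar_matrix_mult_vec tan_def diff_divide_distrib
      algebra_simps)

section \<open>Exponential stability for \<theta> = \<pi> / (2 k)\<close>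

text \<open>
  An odd number is congruent, up to sign, to an odd number \<open>l\<close> with \<open>1 \<le> l \<le> k\<close> modulo
  \<open>2 k\<close>, and the cosine decreases on \<open>[0, \<pi>]\<close>.
\<close>

lemma cos_odd_multiple_le:
  fixes k j :: nat
  assumes "k \<ge> 1" "odd j"
  shows "cos (real j * (pi / k)) \<le> cos (pi / k)"
proof -
  define r where "r = j mod (2 * k)"
  have r: "odd r" "r < 2 * k"
    using assms by (auto simp: r_def dvd_mod_iff)
  have "real j = real (2 * k) * real (j div (2 * k)) + real r"
    unfolding r_def by (metis mult_div_mod_eq of_nat_add of_nat_mult)
  then have "real j * (pi / k) = real r * (pi / k) + 2 * real (j div (2 * k)) * pi"
    using assms(1) by (simp add: field_simps)
  then have red: "cos (real j * (pi / k)) = cos (real r * (pi / k))"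
    by (simp add: cos_add)
  obtain l where l: "1 \<le> l" "l \<le> k" "cos (real r * (pi / k)) = cos (real l * (pi / k))"
  proof (cases "r \<le> k")
    case True
    then show ?thesis using r that[of r] by (cases r) auto
  next
    case False
    have "real r * (pi / k) = 2 * pi - real (2 * k - r) * (pi / k)"
      using assms(1) r(2) by (simp add: of_nat_diff field_simps)
    then have "cos (real r * (pi / k)) = cos (real (2 * k - r) * (pi / k))"
      by (simp add: cos_diff)
    then show ?thesis using False r that[of "2 * k - r"] by auto
  qed
  have "cos (real l * (pi / k)) \<le> cos (pi / k)"
  proof (rule cos_monotone_0_pi_le)
    show "0 \<le> pi / k" by simp
    show "pi / k \<le> real l * (pi / k)"
      using l(1) mult_right_mono[of 1 "real l" "pi / k"] by simp
    show "real l * (pi / k) \<le> pi"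
      using l(2) assms(1) by (simp add: field_simps)
  qed
  with red l(3) show ?thesis by simp
qed

text \<open>The previous bound at the double angle, since \<open>2 cos\<^sup>2 y = 1 + cos (2 y)\<close>.\<close>

lemma abs_cos_odd_multiple_le:
  fixes k n :: nat
  assumes "k \<ge> 1" and \<theta>: "\<theta> = pi / (2 * real k)"
  shows "\<bar>cos (real (2 * n + 1) * \<theta>)\<bar> \<le> cos \<theta>"
proof -
  have "cos (real (2 * n + 1) * (pi / k)) \<le> cos (pi / k)"
    using assms(1) by (intro cos_odd_multiple_le) auto
  moreover have "real (2 * n + 1) * (pi / k) = 2 * (real (2 * n + 1) * \<theta>)" "pi / k = 2 * \<theta>"
    by (simp_all add: \<theta>)
  ultimately have "cos (2 * (real (2 * n + 1) * \<theta>)) \<le> cos (2 * \<theta>)"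
    by (simp only:)
  then have "(cos (real (2 * n + 1) * \<theta>))\<^sup>2 \<le> (cos \<theta>)\<^sup>2"
    unfolding cos_double_cos by simp
  moreover have "0 \<le> cos \<theta>"
  proof (rule cos_ge_zero)
    have "0 \<le> \<theta>" by (simp add: \<theta>)
    then show "- (pi / 2) \<le> \<theta>" by (rule order.trans[rotated]) simp
    show "\<theta> \<le> pi / 2"
      unfolding \<theta> using assms(1) by (intro divide_left_mono) auto
  qed
  ultimately show ?thesis
    using abs_le_square_iff[of "cos (real (2 * n + 1) * \<theta>)" "cos \<theta>"] by simp
qed

text \<open>
  The functional \<open>observation i j \<theta> n\<close> is \<open>cos \<theta>\<close> times what the undamped projection reads off
  after \<open>n\<close> undamped rotations by \<open>2 \<theta>\<close>.
\<close>

definition observation :: "'n \<Rightarrow> 'n \<Rightarrow> real \<Rightarrow> nat \<Rightarrow> real^'n \<Rightarrow> real" where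
  "observation i j \<theta> n x = cos (real (2 * n + 1) * \<theta>) * x $ i - sin (real (2 * n + 1) * \<theta>) * x $ j"

text \<open>
  The set \<open>observation_ball\<close> records a bound on a vector together with bounds on everything that a
  later projection can extract from it.  A rotation only shifts the observations; a
  projection replaces the vector by a multiple of \<open>e\<^sub>i\<close>, whose observations are controlled by
  \<open>abs_cos_odd_multiple_le\<close>.  Up to the damping, both matrices therefore map these sets into
  themselves.
\<close>

definition observation_ball :: "'n \<Rightarrow> 'n \<Rightarrow> real \<Rightarrow> real \<Rightarrow> (real^'n) set" where
  "observation_ball i j \<theta> B = {x. norm x \<le> B \<and> (\<forall>n. \<bar>observation i j \<theta> n x\<bar> \<le> B * cos \<theta>)}"

lemma damped_rotation_observation_ball:
  assumes ij: "i \<noteq> j" and c: "cos \<theta> \<noteq> 0" and damp: "0 \<le> 1 - tan \<theta> ^ 4"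
    and x: "x \<in> observation_ball i j \<theta> B"
  shows "damped_rotation i j (tan \<theta>) *v x \<in> observation_ball i j \<theta> ((1 - tan \<theta> ^ 4) * B)"
proof -
  let ?d = "1 - tan \<theta> ^ 4"
  define a where "a = cos (2 * \<theta>) * x $ i - sin (2 * \<theta>) * x $ j"
  define b where "b = sin (2 * \<theta>) * x $ i + cos (2 * \<theta>) * x $ j"
  have y: "damped_rotation i j (tan \<theta>) *v x = ?d *\<^sub>R (a *\<^sub>R axis i 1 + b *\<^sub>R axis j 1)"
    using damped_rotation_tan_mult_vec[OF ij c] by (simp add: a_def b_def)
  have "a\<^sup>2 + b\<^sup>2 = ((sin (2 * \<theta>))\<^sup>2 + (cos (2 * \<theta>))\<^sup>2) * ((x $ i)\<^sup>2 + (x $ j)\<^sup>2)"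
    unfolding a_def b_def by algebra
  then have "a\<^sup>2 + b\<^sup>2 = (x $ i)\<^sup>2 + (x $ j)\<^sup>2"
    by simp
  then have "norm (a *\<^sub>R axis i 1 + b *\<^sub>R axis j 1 :: real^'a) \<le> B"
    using x norm_planar_projection_le[OF ij, of x]
    by (simp add: norm_planar_vec[OF ij] observation_ball_def)
  then have norm: "norm (?d *\<^sub>R (a *\<^sub>R axis i 1 + b *\<^sub>R axis j 1 :: real^'a)) \<le> ?d * B"
    using damp by (simp add: mult_left_mono)
  have "\<bar>observation i j \<theta> n (?d *\<^sub>R (a *\<^sub>R axis i 1 + b *\<^sub>R axis j 1))\<bar> \<le> ?d * B * cos \<theta>" for n
  proof -
    have next_angle: "real (2 * Suc n + 1) * \<theta> = real (2 * n + 1) * \<theta> + 2 * \<theta>"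
      by (simp add: algebra_simps)
    have "observation i j \<theta> n (?d *\<^sub>R (a *\<^sub>R axis i 1 + b *\<^sub>R axis j 1)) =
          ?d * observation i j \<theta> (Suc n) x"
      using ij unfolding observation_def next_angle cos_add sin_add a_def b_def
      by (simp add: axis_def algebra_simps)
    moreover have "\<bar>observation i j \<theta> (Suc n) x\<bar> \<le> B * cos \<theta>"
      using x by (simp add: observation_ball_def)
    ultimately show ?thesis
      using damp by (simp add: abs_mult mult_left_mono mult.assoc)
  qed
  with norm show ?thesis
    by (simp add: y observation_ball_def)
qed

lemma damped_projection_observation_ball:
  assumes ij: "i \<noteq> j" and k: "k \<ge> 2" and \<theta>: "\<theta> = pi / (2 * real k)"
    and damp: "0 \<le> 1 - tan \<theta> ^ 4"
    and x: "x \<in> observation_ball i j \<theta> B"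
  shows "damped_projection i j (tan \<theta>) *v x \<in> observation_ball i j \<theta> ((1 - tan \<theta> ^ 4) * B)"
proof -
  let ?d = "1 - tan \<theta> ^ 4"
  have c: "cos \<theta> > 0"
    using k by (intro cos_gt_zero_pi) (auto simp: \<theta> field_simps intro: less_le_trans[of _ 0])
  define \<beta> where "\<beta> = observation i j \<theta> 0 x / cos \<theta>"
  have "\<bar>observation i j \<theta> 0 x\<bar> \<le> B * cos \<theta>"
    using x by (simp add: observation_ball_def)
  then have \<beta>: "\<bar>\<beta>\<bar> \<le> B"
    using c by (simp add: \<beta>_def abs_divide field_simps)
  have y: "damped_projection i j (tan \<theta>) *v x = (?d * \<beta>) *\<^sub>R axis i 1"
    using damped_projection_tan_mult_vec[OF ij, of \<theta> x] c by (simp add: \<beta>_def observation_def)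
  have "norm ((?d * \<beta>) *\<^sub>R axis i 1 :: real^'a) \<le> ?d * B"
    using damp \<beta> by (simp add: abs_mult mult_left_mono norm_axis_1)
  moreover have "\<bar>observation i j \<theta> n ((?d * \<beta>) *\<^sub>R axis i 1)\<bar> \<le> ?d * B * cos \<theta>" for n
  proof -
    have "observation i j \<theta> n ((?d * \<beta>) *\<^sub>R axis i 1) = cos (real (2 * n + 1) * \<theta>) * (?d * \<beta>)"
      using ij by (simp add: observation_def axis_def)
    moreover have "\<bar>cos (real (2 * n + 1) * \<theta>)\<bar> * \<bar>?d * \<beta>\<bar> \<le> cos \<theta> * (?d * B)"
      using k damp \<beta> c
      by (intro mult_mono abs_cos_odd_multiple_le[OF _ \<theta>]) (auto simp: abs_mult mult_left_mono)
    ultimately show ?thesis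
      by (simp add: abs_mult mult.commute)
  qed
  ultimately show ?thesis
    by (simp add: y observation_ball_def)
qed

lemma exponentially_stable_at_even_fractions:
  fixes \<nu> :: "real^'n \<Rightarrow> real"
  assumes \<nu>: "is_norm \<nu>" and ij: "i \<noteq> j" and k: "k \<ge> 2"
    and \<theta>: "\<theta> = pi / (2 * real k)" and tan: "0 < tan \<theta>" "tan \<theta> < 1"
  shows "absolutely_exponentially_stable \<nu>
           {damped_rotation i j (tan \<theta>), damped_projection i j (tan \<theta>)}"
proof -
  let ?d = "1 - tan \<theta> ^ 4"
  let ?\<AA> = "{damped_rotation i j (tan \<theta>), damped_projection i j (tan \<theta>)}"
  have d: "0 \<le> ?d" "?d < 1"
    using tan by (auto simp: power_le_one)
  have c: "cos \<theta> > 0"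
    using k by (intro cos_gt_zero_pi) (auto simp: \<theta> field_simps intro: less_le_trans[of _ 0])
  have step: "M *v x \<in> observation_ball i j \<theta> (?d * B)"
    if "M \<in> ?\<AA>" "x \<in> observation_ball i j \<theta> B" for M x B
    using that damped_rotation_observation_ball[OF ij _ d(1)]
      damped_projection_observation_ball[OF ij k \<theta> d(1)] c by auto
  have start: "x \<in> observation_ball i j \<theta> (2 * norm x / cos \<theta>)" for x
  proof -
    have "\<bar>observation i j \<theta> n x\<bar> \<le> 2 * norm x" for n
    proof -
      let ?y = "real (2 * n + 1) * \<theta>"
      have "\<bar>observation i j \<theta> n x\<bar> \<le> \<bar>cos ?y * x $ i\<bar> + \<bar>sin ?y * x $ j\<bar>"
        unfolding observation_def by (rule abs_triangle_ineq4)
      also have "\<dots> = \<bar>cos ?y\<bar> * \<bar>x $ i\<bar> + \<bar>sin ?y\<bar> * \<bar>x $ j\<bar>"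
        by (simp add: abs_mult)
      also have "\<dots> \<le> 1 * norm x + 1 * norm x"
        by (intro add_mono mult_mono component_le_norm_cart) auto
      finally show ?thesis by simp
    qed
    moreover have "norm x * cos \<theta> \<le> norm x * 2"
      by (intro mult_left_mono order.trans[OF cos_le_one]) auto
    ultimately show ?thesis
      using c by (simp add: observation_ball_def pos_le_divide_eq mult.commute)
  qed
  have bound: "matprod A n *v x \<in> observation_ball i j \<theta> (?d ^ n * (2 * norm x / cos \<theta>))"
    if A: "\<forall>n\<ge>1. A n \<in> ?\<AA>" for A x n
  proof (induction n)
    case 0
    then show ?case using start by simp
  next
    case (Suc n)
    have "A (Suc n) \<in> ?\<AA>" using A by simp
    from step[OF this Suc.IH] show ?case
      by (simp only: matprod_Suc_mult_vec power_Suc mult.assoc)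
  qed
  obtain C0 where C0: "\<And>x. \<nu> x \<le> C0 * norm x"
    using is_norm_upper_bound[OF \<nu>] by blast
  define C where "C = max C0 0"
  have C: "\<nu> x \<le> C * norm x" "C \<ge> 0" for x
    using C0[of x] mult_right_mono[of C0 C "norm x"] by (auto simp: C_def)
  obtain e where e: "e > 0" "\<And>x. e * norm x \<le> \<nu> x"
    using is_norm_lower_bound[OF \<nu>] by blast
  have "\<nu> (matprod A n *v x) \<le> (C * 2 / (cos \<theta> * e)) * ?d ^ n * \<nu> x"
    if A: "\<forall>n\<ge>1. A n \<in> ?\<AA>" for A x n
  proof -
    have "\<nu> (matprod A n *v x) \<le> C * norm (matprod A n *v x)"
      by (rule C)
    also have "\<dots> \<le> C * (?d ^ n * (2 * norm x / cos \<theta>))"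
      using bound[OF A, of n x] C(2) by (intro mult_left_mono) (auto simp: observation_ball_def)
    also have "\<dots> = (C * 2 / (cos \<theta> * e)) * ?d ^ n * (e * norm x)"
      using e(1) by (simp add: field_simps)
    also have "\<dots> \<le> (C * 2 / (cos \<theta> * e)) * ?d ^ n * \<nu> x"
      using C(2) c e d(1) by (intro mult_left_mono mult_nonneg_nonneg) auto
    finally show ?thesis .
  qed
  then show ?thesis
    unfolding absolutely_exponentially_stable_def using d(2) by blast
qed

section \<open>Instability for \<theta> = \<pi> / (2 k + 1)\<close>

text \<open>
  The vector \<open>e\<^sub>i\<close> has angle \<open>0\<close>.  After \<open>k\<close> rotations its angle is \<open>2 k \<theta> = \<pi> - \<theta>\<close>, and
  the projection sends the unit vector of that angle to \<open>(cos \<pi> / cos \<theta>) e\<^sub>i\<close>.  The hypothesis on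
  the damping says that this gain outweighs the \<open>k + 1\<close> damping factors of one period.
\<close>

lemma unstable_at_odd_fractions:
  fixes \<nu> :: "real^'n \<Rightarrow> real"
  assumes \<nu>: "is_norm \<nu>" and ij: "i \<noteq> j" and k: "k \<ge> 1"
    and \<theta>: "\<theta> = pi / (2 * real k + 1)" and damp: "cos \<theta> < (1 - tan \<theta> ^ 4) ^ (k + 1)"
  shows "\<not> absolutely_stable \<nu> {damped_rotation i j (tan \<theta>), damped_projection i j (tan \<theta>)}"
proof
  let ?d = "1 - tan \<theta> ^ 4"
  let ?\<AA> = "{damped_rotation i j (tan \<theta>), damped_projection i j (tan \<theta>)}"
  let ?e = "axis i 1 :: real^'n"
  assume "absolutely_stable \<nu> ?\<AA>"
  then obtain c where stable:
    "\<And>A x n. \<lbrakk>\<forall>n\<ge>1. A n \<in> ?\<AA>; n \<ge> 1\<rbrakk> \<Longrightarrow> \<nu> (matprod A n *v x) \<le> c * \<nu> x"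
    unfolding absolutely_stable_def by blast
  have cos_pos: "cos \<theta> > 0"
  proof (rule cos_gt_zero)
    show "0 < \<theta>" by (simp add: \<theta>)
    show "\<theta> < pi / 2"
      unfolding \<theta> using k by (intro divide_strict_left_mono) auto
  qed
  define \<mu> where "\<mu> = ?d ^ (k + 1) / cos \<theta>"
  have \<mu>: "\<mu> > 1"
    using damp cos_pos by (simp add: \<mu>_def field_simps)
  (* The period is k rotations followed by one projection, applied in this order. *)
  define A where "A n = (if (k + 1) dvd n then damped_projection i j (tan \<theta>)
                         else damped_rotation i j (tan \<theta>))" for n
  have A: "\<forall>n\<ge>1. A n \<in> ?\<AA>"
    by (simp add: A_def)
  define u :: "real \<Rightarrow> real^'n" where "u \<alpha> = cos \<alpha> *\<^sub>R axis i 1 + sin \<alpha> *\<^sub>R axis j 1" for \<alpha>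
  have u_components: "u \<alpha> $ i = cos \<alpha>" "u \<alpha> $ j = sin \<alpha>" for \<alpha>
    using ij by (auto simp: u_def axis_def)
  have rotate: "damped_rotation i j (tan \<theta>) *v u \<alpha> = ?d *\<^sub>R u (\<alpha> + 2 * \<theta>)" for \<alpha>
    using cos_pos
    by (simp add: damped_rotation_tan_mult_vec[OF ij] u_components)
       (simp add: u_def cos_add sin_add algebra_simps)
  have project: "damped_projection i j (tan \<theta>) *v u \<alpha> = (?d * (cos (\<alpha> + \<theta>) / cos \<theta>)) *\<^sub>R ?e" for \<alpha>
    using cos_pos
    by (simp add: damped_projection_tan_mult_vec[OF ij] u_components cos_add mult.commute)
  have within_period: "matprod A (q * (k + 1) + r) *v ?e = (b * ?d ^ r) *\<^sub>R u (real r * (2 * \<theta>))"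
    if start: "matprod A (q * (k + 1)) *v ?e = b *\<^sub>R ?e" and "r \<le> k" for q r b
    using \<open>r \<le> k\<close>
  proof (induction r)
    case 0
    then show ?case using start by (simp add: u_def)
  next
    case (Suc r)
    have "\<not> (k + 1) dvd q * (k + 1) + Suc r"
      using Suc.prems by (simp add: dvd_eq_mod_eq_0 del: add_Suc_right mult_Suc_right)
    then have "A (Suc (q * (k + 1) + r)) = damped_rotation i j (tan \<theta>)"
      by (simp add: A_def)
    moreover have "matprod A (q * (k + 1) + r) *v ?e = (b * ?d ^ r) *\<^sub>R u (real r * (2 * \<theta>))"
      using Suc by simp
    ultimately have "matprod A (Suc (q * (k + 1) + r)) *v ?e =
        (b * ?d ^ r * ?d) *\<^sub>R u (real r * (2 * \<theta>) + 2 * \<theta>)"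
      by (simp only: matprod_Suc_mult_vec matrix_vector_mult_scaleR rotate scaleR_scaleR)
    then show ?case
      by (simp add: algebra_simps)
  qed
  have periods: "matprod A (q * (k + 1)) *v ?e = (- \<mu>) ^ q *\<^sub>R ?e" for q
  proof (induction q)
    case 0
    then show ?case by simp
  next
    case (Suc q)
    have last: "Suc (q * (k + 1) + k) = Suc q * (k + 1)"
      by simp
    then have "A (Suc (q * (k + 1) + k)) = damped_projection i j (tan \<theta>)"
      unfolding A_def by (simp only: dvd_triv_right if_True)
    then have "matprod A (Suc q * (k + 1)) *v ?e =
        ((- \<mu>) ^ q * ?d ^ k * (?d * (cos (real k * (2 * \<theta>) + \<theta>) / cos \<theta>))) *\<^sub>R ?e"
      by (simp only: last[symmetric] matprod_Suc_mult_vec within_period[OF Suc.IH order.refl]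
          matrix_vector_mult_scaleR project scaleR_scaleR)
    moreover have "real k * (2 * \<theta>) + \<theta> = (2 * real k + 1) * \<theta>"
      by (simp add: algebra_simps)
    then have "real k * (2 * \<theta>) + \<theta> = pi"
      by (simp add: \<theta>)
    moreover have "?d ^ k * (?d * (cos pi / cos \<theta>)) = - \<mu>"
      by (simp add: \<mu>_def)
    ultimately show ?case
      by (simp only: mult.assoc power_Suc2)
  qed
  have scale: "\<nu> (t *\<^sub>R x) = \<bar>t\<bar> * \<nu> x" for t x
    using \<nu> by (auto simp: is_norm_def)
  have "?e \<noteq> 0"
    by (simp add: axis_eq_0_iff)
  then have e: "\<nu> ?e > 0"
    using \<nu> unfolding is_norm_def by (metis order_le_less)
  have "\<mu> ^ Suc q \<le> c" for q
  proof -
    have "\<mu> ^ Suc q * \<nu> ?e = \<nu> (matprod A (Suc q * (k + 1)) *v ?e)"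
      using \<mu> by (simp only: periods scale power_abs abs_minus_cancel)
    also have "\<dots> \<le> c * \<nu> ?e"
      by (rule stable[OF A]) simp
    finally show ?thesis
      using e by simp
  qed
  moreover obtain q where "c < \<mu> ^ q"
    using real_arch_pow[OF \<mu>] by blast
  moreover have "\<mu> ^ q \<le> \<mu> ^ Suc q"
    using \<mu> by (intro power_increasing) auto
  ultimately show False
    by (meson not_le order.strict_trans2)
qed

section \<open>No semialgebraic set separates the two stability notions\<close>

theorem theorem1:
  fixes \<nu> :: "real^'n \<Rightarrow> real"
    and U :: "(real^'n^'n^'m) set"
  assumes "CARD('m) \<ge> 2" and "CARD('n) \<ge> 2"
    and "is_norm \<nu>"
    and "exp_stable_tuples \<nu> \<subseteq> U" and "U \<subseteq> stable_tuples \<nu>"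
  shows "\<not> semialgebraic U"
proof
  assume "semialgebraic U"
  obtain k l :: 'm where "l \<noteq> k"
    using assms(1) by (metis card_2_iff' ex_card)
  obtain i j :: 'n where ij: "i \<noteq> j"
    using assms(2) by (metis card_2_iff' ex_card)
  define \<gamma> :: "real \<Rightarrow> real^'n^'n^'m" where "\<gamma> = rotation_projection_tuple k i j"
  have range: "range (($) (\<gamma> s)) = {damped_rotation i j s, damped_projection i j s}" for s
    unfolding \<gamma>_def by (rule range_rotation_projection_tuple[OF \<open>l \<noteq> k\<close>])
  have "decided (\<lambda>s. \<gamma> s \<in> U) (at_right 0)"
    using \<open>semialgebraic U\<close> polynomial_rotation_projection_tuple
    unfolding \<gamma>_def by (rule semialgebraic_decided_along_curve)
  then consider "eventually (\<lambda>s. \<gamma> s \<in> U) (at_right 0)" | "eventually (\<lambda>s. \<gamma> s \<notin> U) (at_right 0)"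
    unfolding decided_def by blast
  then show False
  proof cases
    case 1
    have "filterlim (\<lambda>n::nat. tan (pi / (2 * real n + 1))) (at_right 0) at_top"
      by real_asymp
    then have "eventually (\<lambda>n::nat. \<gamma> (tan (pi / (2 * real n + 1))) \<in> U) at_top"
      using 1 by (auto simp: filterlim_iff)
    (* The left side is 1 - theta^2/2 + O(theta^4), the right side 1 - O(theta^3). *)
    moreover have "eventually (\<lambda>n::nat. cos (pi / (2 * real n + 1)) <
        (1 - tan (pi / (2 * real n + 1)) ^ 4) ^ (n + 1)) at_top"
      by real_asymp
    moreover have "eventually (\<lambda>n::nat. n \<ge> 1) at_top"
      by (rule eventually_ge_at_top)
    ultimately have "eventually (\<lambda>n::nat. False) at_top"
    proof eventually_elim
      case (elim n)
      have "absolutely_stable \<nu> (range (($) (\<gamma> (tan (pi / (2 * real n + 1))))))"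
        using elim(1) assms(5) by (auto simp: stable_tuples_def)
      then show False
        using unstable_at_odd_fractions[OF assms(3) ij elim(3) refl elim(2)] range by simp
    qed
    then show False by simp
  next
    case 2
    have lim: "filterlim (\<lambda>n::nat. tan (pi / (2 * real n))) (at_right 0) at_top"
      by real_asymp
    then have "eventually (\<lambda>n::nat. \<gamma> (tan (pi / (2 * real n))) \<notin> U) at_top"
      using 2 by (auto simp: filterlim_iff)
    moreover have "eventually (\<lambda>n::nat. 0 < tan (pi / (2 * real n))) at_top"
      by real_asymp
    moreover have "eventually (\<lambda>n::nat. tan (pi / (2 * real n)) < 1) at_top"
      by real_asymp
    moreover have "eventually (\<lambda>n::nat. n \<ge> 2) at_top"
      by (rule eventually_ge_at_top)
    ultimately have "eventually (\<lambda>n::nat. False) at_top"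
    proof eventually_elim
      case (elim n)
      have "\<gamma> (tan (pi / (2 * real n))) \<in> exp_stable_tuples \<nu>"
        using exponentially_stable_at_even_fractions[OF assms(3) ij elim(4) refl elim(2,3)] range
        by (simp add: exp_stable_tuples_def)
      then show False
        using elim(1) assms(4) by blast
    qed
    then show False by simp
  qed
qed

end
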